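(* Let $f:\mathbb{F}_{2^n}\to\mathbb{F}_{2^n}$ with $f(0)=0$, and let $\xi\in\mathbb{F}_{2^n}^*$. Let $\mathcal{P}_n:=\{1/(1+\alpha):\alpha\text{ a primitive element of }\mathbb{F}_{2^n}\}\cup\{1\}$. If $\mathcal{P}_n$ spans $\mathbb{F}_{2^n}$ as a vector space over $\mathbb{F}_2$, then the following are equivalent: (1) $\{(a,\xi/a):a\in\mathbb{F}_{2^n}\}\subseteq\mathcal{A}_f$ (with the convention $\xi/0:=0$); (2) $f$ is additive.
   Context: $\mathcal{A}_f:=\{(a,b)\in\mathbb{F}_{2^n}^2: f(x+a)+f(x)+f(x+b+a)+f(x+b)=0\text{ for all }x\in\mathbb{F}_{2^n}\}$. *)

theory Defs
  imports "HOL-Library.Z2" "HOL-Library.Cardinality" "HOL-Computational_Algebra.Primes" "HOL-Number_Theory.Residues"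
begin

definition vanishing_pairs :: "('a::finite_field \<Rightarrow> 'a) \<Rightarrow> ('a \<times> 'a) set" where
  "vanishing_pairs f = {(a, b). \<forall>x. f (x + a) + f x + f (x + b + a) + f (x + b) = 0}"

text \<open>A primitive element is a generator of the multiplicative group of the field. (No separate
  condition \<^prop>\<open>\<alpha> \<noteq> 0\<close> is needed: the powers of \<open>0\<close> include \<open>0\<close> itself.)\<close>

definition primitive_element :: "'a::finite_field \<Rightarrow> bool" where
  "primitive_element \<alpha> \<longleftrightarrow> range (\<lambda>k::int. \<alpha> powi k) = UNIV - {0}"

text \<open>In characteristic 2 the denominator vanishes only for \<open>\<alpha> = 1\<close>, which is primitive only in
  the field with two elements. There the totalised division adds \<open>0\<close> to the set, which does not
  change its span.\<close>

definition P_set :: "'a::finite_field set" where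
  "P_set = {1 / (1 + \<alpha>) | \<alpha>. primitive_element \<alpha>} \<union> {1}"

definition scale2 :: "bit \<Rightarrow> 'a::finite_field \<Rightarrow> 'a" where
  "scale2 c x = (if c = 1 then x else 0)"

lemma two_eq_zero:
  assumes "card (UNIV :: 'a::finite_field set) = 2 ^ n"
  shows "(2::'a) = 0"
proof -
  have "prime CHAR('a)"
    by (rule prime_CHAR_semidom) (simp add: finite_imp_CHAR_pos)
  moreover have "CHAR('a) dvd 2 ^ n"
    using CHAR_dvd_CARD[where ?'a = 'a] assms by simp
  ultimately have "CHAR('a) = 2"
    using prime_dvd_power primes_dvd_imp_eq two_is_prime_nat by blast
  then show ?thesis
    by (metis of_nat_CHAR of_nat_numeral)
qed

lemma vector_space_scale2:
  assumes "card (UNIV :: 'a::finite_field set) = 2 ^ n"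
  shows "vector_space (scale2 :: bit \<Rightarrow> 'a \<Rightarrow> 'a)"
proof -
  have "x + x = 0" for x :: 'a
    using two_eq_zero[OF assms] by (metis mult_2 mult_zero_left)
  then show ?thesis
    by unfold_locales (auto simp: scale2_def)
qed

end

theory Submission
  imports Defs
begin

text \<open>Write \<open>D\<^sub>a f x = f (x + a) + f x\<close>, so that \<open>(a, b)\<close> is a vanishing pair iff \<open>b\<close> is a period of
  \<open>D\<^sub>a f\<close>; the periods of a function form a subspace over the field with two elements.
  For \<open>\<beta> = 1 / (1 + \<alpha>)\<close> put \<open>H\<^sub>a = D\<^sub>a D\<^sub>b f\<close> with \<open>b = \<beta> \<xi> / a\<close>. As
  \<open>\<xi> / (a + \<alpha> a) = \<beta> \<xi> / a\<close> is a period of \<open>D\<^bsub>a + \<alpha> a\<^esub> f\<close>, and \<open>\<alpha> \<beta> = 1 + \<beta>\<close>, one finds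
  \<open>H\<^bsub>\<alpha> a\<^esub> = H\<^sub>a\<close>. If \<open>\<alpha>\<close> is primitive, \<open>H\<^sub>a\<close> is thus independent of \<open>a \<noteq> 0\<close>; having every \<open>a\<close> as
  a period it is constant, and the constant is \<open>0\<close> because \<open>D\<^sub>a D\<^sub>a f = 0\<close> for \<open>a\<^sup>2 = \<beta> \<xi>\<close>.
  Hence the periods of \<open>D\<^sub>a f\<close> contain \<open>\<beta> \<xi> / a\<close> for all \<open>\<beta>\<close> in the spanning set, that is,
  they are the whole field.\<close>

definition difference :: "'a::ab_group_add \<Rightarrow> ('a \<Rightarrow> 'a) \<Rightarrow> 'a \<Rightarrow> 'a" where
  "difference a f x = f (x + a) + f x"

definition periods :: "('a::ab_group_add \<Rightarrow> 'b) \<Rightarrow> 'a set" where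
  "periods g = {b. \<forall>x. g (x + b) = g x}"

lemma periodsD: "b \<in> periods g \<Longrightarrow> g (x + b) = g x"
  by (simp add: periods_def)

lemma zero_in_periods: "0 \<in> periods g"
  by (simp add: periods_def)

lemma add_in_periods: "b \<in> periods g \<Longrightarrow> c \<in> periods g \<Longrightarrow> b + c \<in> periods g"
  unfolding periods_def by (simp flip: add.assoc)

lemma add_self_char_2: "(2::'a::comm_ring_1) = 0 \<Longrightarrow> x + x = (0::'a)"
  by (metis mult_2 mult_zero_left)

lemma add_eq_0_iff_char_2:
  assumes "(2::'a::comm_ring_1) = 0"
  shows "x + y = 0 \<longleftrightarrow> x = (y::'a)"
  using add_self_char_2[OF assms] by (metis add.assoc add.left_neutral add.right_neutral)

text \<open>In characteristic 2 the cross terms of \<open>(x + y) * (x + y)\<close> cancel, so equal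
  squares force \<open>x + y = 0\<close>; injectivity on a finite type then gives square
  roots.\<close>

lemma surj_square_char_2:
  assumes "(2::'a::finite_field) = 0"
  shows "surj (\<lambda>x::'a. x * x)"
proof (rule finite_UNIV_inj_surj)
  show "inj (\<lambda>x::'a. x * x)"
  proof (rule injI)
    fix x y :: 'a
    assume "x * x = y * y"
    then have "(x + y) * (x + y) = 0"
      using add_self_char_2[OF assms, of "x * y"] add_self_char_2[OF assms, of "y * y"]
      by (metis (no_types, lifting) add.assoc add.right_neutral distrib_left distrib_right
          mult.commute)
    then show "x = y"
      by (simp add: add_eq_0_iff_char_2[OF assms])
  qed
qed simp

lemma vanishing_pairs_iff_periods:
  assumes "(2::'a::finite_field) = 0"
  shows "(a, b) \<in> vanishing_pairs f \<longleftrightarrow> b \<in> periods (difference a (f :: 'a \<Rightarrow> 'a))"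
proof -
  have "f (x + a) + f x + f (x + b + a) + f (x + b) = 0
      \<longleftrightarrow> f (x + b + a) + f (x + b) = f (x + a) + f x" for x
    using add_eq_0_iff_char_2[OF assms] by (metis add.assoc)
  then show ?thesis
    by (simp add: vanishing_pairs_def periods_def difference_def)
qed

lemma additive_imp_vanishing_pair:
  assumes "(2::'a::finite_field) = 0" "additive f"
  shows "(a, b) \<in> vanishing_pairs (f :: 'a \<Rightarrow> 'a)"
proof -
  have "f (x + a) + f x + f (x + b + a) + f (x + b)
      = (f x + f x) + (f x + f x) + (f a + f a) + (f b + f b)" for x
    by (simp add: additive.add[OF assms(2)] add_ac)
  then show ?thesis
    by (simp add: vanishing_pairs_def add_self_char_2[OF assms(1)])
qed

lemma self_in_periods_difference:
  assumes "(2::'a::comm_ring_1) = 0"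
  shows "a \<in> periods (difference (a::'a) f)"
  by (simp add: periods_def difference_def add.assoc assms add.commute)

lemma difference_commute: "difference a (difference b f) = difference b (difference a f)"
  by (simp add: difference_def fun_eq_iff add_ac)

lemma difference_add:
  assumes "(2::'a::comm_ring_1) = 0"
  shows "difference (a + b) f x = difference a f (x + b) + difference (b::'a) f x"
proof -
  have "difference a f (x + b) + difference b f x
      = f (x + b + a) + (f (x + b) + f (x + b)) + f x"
    by (simp add: difference_def add_ac)
  then show ?thesis
    by (simp add: difference_def add_self_char_2[OF assms] add_ac)
qed

lemma difference_period:
  assumes "(2::'a::comm_ring_1) = 0" "b \<in> periods g"
  shows "difference b g x = (0::'a)"
  using assms by (simp add: difference_def periodsD add_self_char_2)

lemma periods_difference_mono: "periods g \<subseteq> periods (difference b g)"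
proof
  fix c
  assume "c \<in> periods g"
  then have "g (x + c + b) = g (x + b)" for x
    using periodsD[of c g "x + b"] by (simp add: add_ac)
  with \<open>c \<in> periods g\<close> show "c \<in> periods (difference b g)"
    by (simp add: periods_def difference_def)
qed

text \<open>Every nonzero \<open>a\<close> is an integer power of \<open>\<alpha>\<close>, so
  invariance is carried from exponent 0 upwards and downwards.\<close>

lemma primitive_element_invariant_const:
  assumes "primitive_element \<alpha>" "\<And>a. a \<noteq> 0 \<Longrightarrow> H (\<alpha> * a) = H a" "a \<noteq> 0"
  shows "H a = H (1::'a::finite_field)"
proof -
  have nz: "\<alpha> \<noteq> 0"
    using assms(1) rangeI[of "\<lambda>k::int. \<alpha> powi k" 1] by (auto simp: primitive_element_def)
  have step: "H (\<alpha> powi (k + 1)) = H (\<alpha> powi k)" for k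
    using assms(2)[of "\<alpha> powi k"] nz by (simp add: power_int_add mult.commute)
  have "H (\<alpha> powi k) = H 1" for k
  proof (induction k rule: int_induct[where k = 0])
    case (step2 i)
    then show ?case using step[of "i - 1"] by simp
  qed (simp_all add: step)
  moreover obtain k :: int where "a = \<alpha> powi k"
    using assms(1,3) unfolding primitive_element_def by blast
  ultimately show ?thesis by simp
qed

lemma primitive_quotient_in_periods:
  fixes f :: "'a::finite_field \<Rightarrow> 'a"
  assumes two: "(2::'a) = 0"
    and per: "\<And>a. \<xi> / a \<in> periods (difference a f)"
    and prim: "primitive_element \<alpha>"
    and a: "a \<noteq> 0"
  shows "1 / (1 + \<alpha>) * (\<xi> / a) \<in> periods (difference a f)"
\<comment> \<open>In the degenerate cases the claimed period is \<open>\<xi> / a\<close> or, using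
  division by zero, 0.\<close>
proof (cases "\<alpha> = 0 \<or> 1 + \<alpha> = 0 \<or> \<xi> = 0")
  case True
  then show ?thesis
    using per[of a] zero_in_periods[of "difference a f"] by auto
next
  case False
  define \<beta> where "\<beta> = 1 / (1 + \<alpha>)"
  define H where "H a = difference (\<beta> * (\<xi> / a)) (difference a f)" for a
  have "\<alpha> * \<beta> + \<beta> = 1"
    using False by (simp add: \<beta>_def field_simps)
  then have \<alpha>\<beta>: "\<alpha> * \<beta> = 1 + \<beta>"
    using add_self_char_2[OF two, of \<beta>] by (metis add.assoc add.right_neutral)
  have H_periodic: "H a (x + a) = H a x" for a x
    unfolding H_def
    by (intro periodsD subsetD[OF periods_difference_mono] self_in_periods_difference two)
  have H_shift: "H a (x + \<alpha> * a) = H (\<alpha> * a) x" if "a \<noteq> 0" for a x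
  proof -
    define c where "c = \<beta> * (\<xi> / a)"
    have "c = \<xi> / (a + \<alpha> * a)"
      using that False by (simp add: c_def \<beta>_def field_simps)
    then have "c \<in> periods (difference (a + \<alpha> * a) f)"
      using per by simp
    then have "difference c (difference (a + \<alpha> * a) f) x = 0"
      by (rule difference_period[OF two])
    then have "difference c (difference a f) (x + \<alpha> * a)
        + difference c (difference (\<alpha> * a) f) x = 0"
      unfolding difference_commute[of c] difference_add[OF two] .
    then have shift: "H a (x + \<alpha> * a) = difference c (difference (\<alpha> * a) f) x"
      by (simp add: H_def c_def add_eq_0_iff_char_2[OF two])
    have "c = (1 + \<beta>) * (\<xi> / (\<alpha> * a))"
      using that False by (simp add: c_def flip: \<alpha>\<beta>)
    then have "c = \<beta> * (\<xi> / (\<alpha> * a)) + \<xi> / (\<alpha> * a)"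
      by (simp add: distrib_right add_divide_distrib add.commute)
    then have "difference c (difference (\<alpha> * a) f) y = H (\<alpha> * a) y" for y
      using periodsD[OF per]
      by (simp add: H_def difference_def[of _ "difference _ _"] flip: add.assoc)
    with shift show ?thesis
      by simp
  qed
  \<comment> \<open>The period \<open>\<alpha> * a\<close> of \<open>H (\<alpha> * a)\<close>
    supplies a second shift, which cancels the one in \<open>H_shift\<close>.\<close>
  have H_mult: "H (\<alpha> * a) = H a" if "a \<noteq> 0" for a
  proof
    fix x
    have "H (\<alpha> * a) x = H (\<alpha> * a) (x + \<alpha> * a)"
      by (simp only: H_periodic)
    also have "\<dots> = H a (x + (\<alpha> * a + \<alpha> * a))"
      using H_shift[OF that, of "x + \<alpha> * a"] by (simp add: add.assoc)
    also have "\<dots> = H a x"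
      by (simp add: add_self_char_2[OF two])
    finally show "H (\<alpha> * a) x = H a x" .
  qed
  have H_eq: "H a = H 1" if "a \<noteq> 0" for a
    using primitive_element_invariant_const[of \<alpha> H, OF prim H_mult that] .
  \<comment> \<open>For nonzero \<open>x\<close>, \<open>H 1\<close> equals \<open>H x\<close>,
    which has period \<open>x\<close>.\<close>
  have H_const: "H 1 x = H 1 0" for x
    using H_periodic[of x 0] H_eq[of x] by (cases "x = 0") auto
  \<comment> \<open>This choice makes both differences in \<open>H s\<close> have the same step
    \<open>s\<close>.\<close>
  obtain s where s: "s * s = \<beta> * \<xi>"
    using surj_square_char_2[OF two] by (metis surjD)
  have "s \<noteq> 0"
    using s False by (auto simp: \<beta>_def)
  then have "\<beta> * (\<xi> / s) = s"
    using s by (simp add: field_simps)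
  then have "H s 0 = 0"
    unfolding H_def using difference_period[OF two self_in_periods_difference[OF two]] by simp
  then have "H a x = 0" for x
    using H_const[of x] H_eq[OF a] H_eq[OF \<open>s \<noteq> 0\<close>] by simp
  then show ?thesis
    by (simp add: H_def periods_def difference_def[of _ "difference _ _"] \<beta>_def
        add_eq_0_iff_char_2[OF two])
qed

theorem theorem4:
  fixes f :: "'a::finite_field \<Rightarrow> 'a" and \<xi> :: 'a and n :: nat
  assumes "CARD('a) = 2 ^ n"
    and "f 0 = 0"
    and "\<xi> \<noteq> 0"
    and "module.span scale2 (P_set :: 'a set) = UNIV"
  shows "{(a, \<xi> / a) | a. a \<in> UNIV} \<subseteq> vanishing_pairs f \<longleftrightarrow> additive f"
proof
  have two: "(2::'a) = 0"
    using two_eq_zero assms(1) .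
  interpret vector_space "scale2 :: bit \<Rightarrow> 'a \<Rightarrow> 'a"
    using vector_space_scale2 assms(1) .
  show "{(a, \<xi> / a) | a. a \<in> UNIV} \<subseteq> vanishing_pairs f" if "additive f"
    using additive_imp_vanishing_pair[OF two that] by auto
  assume "{(a, \<xi> / a) | a. a \<in> UNIV} \<subseteq> vanishing_pairs f"
  then have per: "\<xi> / a \<in> periods (difference a f)" for a
    unfolding vanishing_pairs_iff_periods[OF two, symmetric] by blast
  have all_periods: "b \<in> periods (difference a f)" if a: "a \<noteq> 0" for a b
  proof -
    \<comment> \<open>Rescaling the periods by \<open>a / \<xi>\<close> gives a set that contains
      \<open>P_set\<close> independently of \<open>a\<close>; with scalars 0 and 1, closure under
      addition makes it a subspace.\<close>
    let ?V = "{c. c * (\<xi> / a) \<in> periods (difference a f)}"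
    have "subspace ?V"
      by (auto simp: subspace_def scale2_def distrib_right add_divide_distrib zero_in_periods
          intro: add_in_periods)
    moreover have "P_set \<subseteq> ?V"
      using primitive_quotient_in_periods[OF two per _ a] per[of a] by (auto simp: P_set_def)
    ultimately have "span P_set \<subseteq> ?V"
      by (simp add: span_minimal)
    then have "b * (a / \<xi>) \<in> ?V"
      by (rule subsetD) (simp add: assms(4))
    then show ?thesis
      using a assms(3) by simp
  qed
  show "additive f"
  proof
    fix a b
    show "f (a + b) = f a + f b"
    proof (cases "a = 0")
      case False
      \<comment> \<open>Evaluating the period \<open>b\<close> at 0 brings in
        \<open>f 0 = 0\<close>.\<close>
      then have "difference a f (0 + b) = difference a f 0"
        by (intro periodsD all_periods)
      then have "f (a + b) + f b = f a"
        by (simp add: difference_def assms(2) add.commute)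
      then have "f (a + b) + (f b + f b) = f a + f b"
        by (simp only: add.assoc[symmetric])
      then show ?thesis
        by (simp add: add_self_char_2[OF two])
    qed (use assms(2) in simp)
  qed
qed

end
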